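(* Let $N:\mathbb{C}^n\to\mathbb{C}^n$ be a nilpotent morphism of polynomial degree $\deg_p N\le 2$. Then $N$ possesses at most one fixed point.
   Context: A morphism $N=(N_1,\dots,N_n):\mathbb{C}^n\to\mathbb{C}^n$ is a mapping given by polynomials $N_i\in\mathbb{C}[X_1,\dots,X_n]$. Its polynomial degree is $\deg_p N=\max_i\deg N_i(X)$. It is nilpotent if its Jacobi matrix $JN(X)=\left(\frac{\partial N_i}{\partial X_j}\right)$ satisfies $(JN(X))^n\equiv 0$ in the ring of $n\times n$ matrices over $\mathbb{C}[X_1,\dots,X_n]$. A fixed point of $N$ is a point $x\in\mathbb{C}^n$ with $N(x)=x$. *)

theory Defs
  imports "HOL-Analysis.Analysis" "HOL-Library.Poly_Mapping"
begin

text \<open>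
  The polynomial ring over \<open>'a\<close> in variables indexed by the finite type \<open>'n\<close>:
  finitely supported maps from exponent vectors to coefficients, with the
  convolution product of \<open>Poly_Mapping\<close>. For \<open>'a :: comm_ring_1\<close> it is a
  commutative ring, so matrices over it have the usual product.
\<close>

type_synonym ('n, 'a) mpoly = "('n \<Rightarrow>\<^sub>0 nat) \<Rightarrow>\<^sub>0 'a"

definition mpoly_eval :: "('n::finite, 'a::comm_ring_1) mpoly \<Rightarrow> 'a ^ 'n \<Rightarrow> 'a" where
  "mpoly_eval p x =
     (\<Sum>m\<in>Poly_Mapping.keys p.
        Poly_Mapping.lookup p m * (\<Prod>i\<in>UNIV. (x $ i) ^ Poly_Mapping.lookup m i))"

text \<open>Total degree; the zero polynomial gets degree 0.\<close>

definition mpoly_degree :: "('n::finite, 'a::zero) mpoly \<Rightarrow> nat" where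
  "mpoly_degree p =
     Max (insert 0 ((\<lambda>m. \<Sum>i\<in>UNIV. Poly_Mapping.lookup m i) ` Poly_Mapping.keys p))"

text \<open>
  Formal partial derivative. Where the exponent of variable \<open>j\<close> in \<open>m\<close> is 0 the
  subtraction of exponents truncates, but the coefficient is then 0.
\<close>

definition mpoly_pderiv ::
  "'n::finite \<Rightarrow> ('n, 'a::comm_ring_1) mpoly \<Rightarrow> ('n, 'a) mpoly" where
  "mpoly_pderiv j p =
     (\<Sum>m\<in>Poly_Mapping.keys p.
        Poly_Mapping.single (m - Poly_Mapping.single j 1)
          (of_nat (Poly_Mapping.lookup m j) * Poly_Mapping.lookup p m))"

definition poly_morphism ::
  "('n::finite, 'a::comm_ring_1) mpoly ^ 'n \<Rightarrow> 'a ^ 'n \<Rightarrow> 'a ^ 'n" where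
  "poly_morphism P x = (\<chi> i. mpoly_eval (P $ i) x)"

definition poly_deg :: "('n::finite, 'a::zero) mpoly ^ 'n \<Rightarrow> nat" where
  "poly_deg P = Max (range (\<lambda>i. mpoly_degree (P $ i)))"

definition jacobi_matrix ::
  "('n::finite, 'a::comm_ring_1) mpoly ^ 'n \<Rightarrow> ('n, 'a) mpoly ^ 'n ^ 'n" where
  "jacobi_matrix P = (\<chi> i j. mpoly_pderiv j (P $ i))"

text \<open>
  Power for the matrix product; the overloaded \<open>^\<close> on vectors and matrices is componentwise.
\<close>

definition matrix_power :: "'a::semiring_1 ^ 'n::finite ^ 'n \<Rightarrow> nat \<Rightarrow> 'a ^ 'n ^ 'n" where
  "matrix_power A k = (((**) A) ^^ k) (mat 1)"

definition nilpotent_morphism :: "('n::finite, 'a::comm_ring_1) mpoly ^ 'n \<Rightarrow> bool" where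
  "nilpotent_morphism P \<longleftrightarrow> matrix_power (jacobi_matrix P) CARD('n) = 0"

end

theory Submission
  imports Defs
begin

text \<open>
  A polynomial map of degree at most 2 satisfies
  \<open>N x - N y = JN ((x + y) / 2) (x - y)\<close> exactly. For fixed points \<open>x\<close>, \<open>y\<close> the vector
  \<open>x - y\<close> is therefore fixed by a nilpotent matrix, so it is 0.
\<close>

definition monom_eval :: "('n::finite \<Rightarrow>\<^sub>0 nat) \<Rightarrow> 'a::comm_ring_1 ^ 'n \<Rightarrow> 'a" where
  "monom_eval m x = (\<Prod>i\<in>UNIV. (x $ i) ^ Poly_Mapping.lookup m i)"

lemma monom_eval_0 [simp]: "monom_eval 0 x = 1"
  by (simp add: monom_eval_def)

lemma monom_eval_add: "monom_eval (m + m') x = monom_eval m x * monom_eval m' x"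
  by (simp add: monom_eval_def lookup_add power_add prod.distrib)

lemma monom_eval_single [simp]: "monom_eval (Poly_Mapping.single a (Suc 0)) x = x $ a"
proof -
  have "monom_eval (Poly_Mapping.single a (Suc 0)) x = (\<Prod>i\<in>UNIV. if i = a then x $ i else 1)"
    unfolding monom_eval_def by (rule prod.cong) (auto simp: lookup_single)
  then show ?thesis by simp
qed

text \<open>Monomials outside the support have coefficient 0. The free choice of \<open>S\<close>
  lets several polynomials be evaluated over one common index set, which makes additivity a termwise
  matter.\<close>

lemma mpoly_eval_superset:
  assumes "finite S" "Poly_Mapping.keys p \<subseteq> S"
  shows "mpoly_eval p x = (\<Sum>m\<in>S. Poly_Mapping.lookup p m * monom_eval m x)"
  unfolding mpoly_eval_def monom_eval_def
  by (rule sum.mono_neutral_left) (use assms in \<open>auto simp: in_keys_iff\<close>)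

lemma mpoly_eval_0 [simp]: "mpoly_eval 0 x = 0"
  by (simp add: mpoly_eval_def)

lemma mpoly_eval_single [simp]: "mpoly_eval (Poly_Mapping.single m c) x = c * monom_eval m x"
  by (subst mpoly_eval_superset[of "{m}"]) auto

lemma mpoly_eval_1 [simp]: "mpoly_eval 1 x = 1"
  by (metis monom_eval_0 mpoly_eval_single mult_1 single_one)

lemma mpoly_eval_add: "mpoly_eval (p + q) x = mpoly_eval p x + mpoly_eval q x"
proof -
  let ?S = "Poly_Mapping.keys p \<union> Poly_Mapping.keys q"
  have "Poly_Mapping.keys (p + q) \<subseteq> ?S" by (rule keys_add)
  then show ?thesis
    by (simp add: mpoly_eval_superset[of ?S] lookup_add distrib_right sum.distrib)
qed

lemma mpoly_eval_sum: "mpoly_eval (\<Sum>i\<in>A. f i) x = (\<Sum>i\<in>A. mpoly_eval (f i) x)"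
  by (induction A rule: infinite_finite_induct) (auto simp: mpoly_eval_add)

lemma poly_mapping_sum_singles:
  "p = (\<Sum>m\<in>Poly_Mapping.keys p. Poly_Mapping.single m (Poly_Mapping.lookup p m))"
  by (rule poly_mapping_eqI)
    (auto simp: lookup_sum lookup_single when_def in_keys_iff sum.delta)

text \<open>Both factors are split into single terms, on which convolution just adds exponents.
  Different pairs may give the same exponent, but additivity of evaluation makes collecting them
  unnecessary.\<close>

lemma mpoly_eval_mult: "mpoly_eval (p * q) x = mpoly_eval p x * mpoly_eval q x"
proof -
  have "p * q = (\<Sum>m\<in>Poly_Mapping.keys p. \<Sum>m'\<in>Poly_Mapping.keys q.
      Poly_Mapping.single (m + m') (Poly_Mapping.lookup p m * Poly_Mapping.lookup q m'))"
    by (subst poly_mapping_sum_singles[of p], subst poly_mapping_sum_singles[of q]) (simp add: sum_product mult_single)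
  then have "mpoly_eval (p * q) x = (\<Sum>m\<in>Poly_Mapping.keys p. \<Sum>m'\<in>Poly_Mapping.keys q.
      Poly_Mapping.lookup p m * Poly_Mapping.lookup q m' * monom_eval (m + m') x)"
    by (simp only: mpoly_eval_sum mpoly_eval_single)
  also have "\<dots> = mpoly_eval p x * mpoly_eval q x"
    by (simp add: mpoly_eval_def monom_eval_add sum_product ac_simps flip: monom_eval_def)
  finally show ?thesis .
qed

text \<open>Splits one variable off a nonconstant monomial; two applications are enough to reach
  every monomial of degree at most 2.\<close>

lemma poly_mapping_nat_nonzeroE:
  fixes m :: "'n \<Rightarrow>\<^sub>0 nat"
  assumes "m \<noteq> 0"
  obtains a m' where "m = Poly_Mapping.single a (Suc 0) + m'"
proof -
  obtain a where a: "Poly_Mapping.lookup m a \<noteq> 0"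
    using assms by (metis lookup_zero poly_mapping_eqI)
  have "m = Poly_Mapping.single a (Suc 0) + (m - Poly_Mapping.single a (Suc 0))"
    by (rule poly_mapping_eqI) (use a in \<open>auto simp: lookup_add lookup_minus lookup_single when_def\<close>)
  then show thesis by (rule that)
qed

text \<open>On the line through \<open>x\<close> and \<open>y\<close> such a monomial is a
  polynomial of degree at most 2 in the parameter, and the secant slope of a quadratic is its
  derivative at the midpoint. The proof checks the shapes 1, \<open>X_a\<close> and
  \<open>X_a X_b\<close> directly.\<close>

lemma monom_eval_diff_midpoint:
  fixes x y :: "'a::field_char_0 ^ 'n::finite"
  assumes "(\<Sum>i\<in>UNIV. Poly_Mapping.lookup m i) \<le> 2"
  defines "z \<equiv> (\<chi> i. (x $ i + y $ i) / 2)"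
  shows "monom_eval m x - monom_eval m y =
    (\<Sum>j\<in>UNIV. of_nat (Poly_Mapping.lookup m j) *
      monom_eval (m - Poly_Mapping.single j 1) z * (x $ j - y $ j))"
proof (cases "m = 0")
  case False
  let ?e = "\<lambda>a. Poly_Mapping.single a (Suc 0) :: 'n \<Rightarrow>\<^sub>0 nat"
  have lookup_e: "Poly_Mapping.lookup (?e a) j = (if j = a then 1 else 0)" for a j
    by (auto simp: lookup_single)
  obtain a m' where m: "m = ?e a + m'" using False by (rule poly_mapping_nat_nonzeroE)
  show ?thesis
  proof (cases "m' = 0")
    case True
    have "of_nat (Poly_Mapping.lookup m j) * monom_eval (m - ?e j) z * (x $ j - y $ j) =
        (if j = a then x $ j - y $ j else 0)" for j
      by (simp add: m True lookup_e)
    then show ?thesis by (simp add: m True)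
  next
    case False
    then obtain b m'' where m': "m' = ?e b + m''" by (rule poly_mapping_nat_nonzeroE)
    \<comment> \<open>The two variables split off already use up the whole degree.\<close>
    have "m'' = 0"
      using assms(1) by (auto simp: m m' lookup_add lookup_e sum.distrib intro!: poly_mapping_eqI)
    then have mab: "m = ?e a + ?e b" by (simp add: m m')
    \<comment> \<open>This form also covers \<open>a = b\<close>: both summands are then active at
      \<open>j = a\<close> and add up to the derivative \<open>2 * z $ a\<close> of the
      square.\<close>
    have "of_nat (Poly_Mapping.lookup m j) * monom_eval (m - ?e j) z * (x $ j - y $ j) =
        (if j = a then z $ b * (x $ j - y $ j) else 0) +
        (if j = b then z $ a * (x $ j - y $ j) else 0)" for j
      by (auto simp: mab lookup_add lookup_e algebra_simps)
    then have "(\<Sum>j\<in>UNIV. of_nat (Poly_Mapping.lookup m j) * monom_eval (m - ?e j) z *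
        (x $ j - y $ j)) = z $ b * (x $ a - y $ a) + z $ a * (x $ b - y $ b)"
      by (simp add: sum.distrib)
    \<comment> \<open>With \<open>z\<close> the midpoint, the mixed terms
      \<open>x $ a * y $ b\<close> and \<open>y $ a * x $ b\<close> cancel.\<close>
    also have "\<dots> = x $ a * x $ b - y $ a * y $ b"
      by (simp add: z_def field_simps)
    finally show ?thesis by (simp add: mab monom_eval_add)
  qed
qed simp

lemma mpoly_eval_diff_midpoint:
  fixes x y :: "'a::field_char_0 ^ 'n::finite"
  assumes "mpoly_degree p \<le> 2"
  shows "mpoly_eval p x - mpoly_eval p y =
    (\<Sum>j\<in>UNIV. mpoly_eval (mpoly_pderiv j p) (\<chi> i. (x $ i + y $ i) / 2) * (x $ j - y $ j))"
proof -
  let ?z = "\<chi> i. (x $ i + y $ i) / 2"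
  have deg: "(\<Sum>i\<in>UNIV. Poly_Mapping.lookup m i) \<le> 2" if "m \<in> Poly_Mapping.keys p" for m
    using assms that by (auto simp: mpoly_degree_def)
  have "mpoly_eval p x - mpoly_eval p y = (\<Sum>m\<in>Poly_Mapping.keys p.
      Poly_Mapping.lookup p m * (monom_eval m x - monom_eval m y))"
    by (simp add: mpoly_eval_def right_diff_distrib sum_subtractf flip: monom_eval_def)
  also have "\<dots> = (\<Sum>m\<in>Poly_Mapping.keys p. \<Sum>j\<in>UNIV. of_nat (Poly_Mapping.lookup m j) *
      Poly_Mapping.lookup p m * monom_eval (m - Poly_Mapping.single j 1) ?z * (x $ j - y $ j))"
    by (rule sum.cong)
      (simp_all add: monom_eval_diff_midpoint deg sum_distrib_left ac_simps)
  also have "\<dots> = (\<Sum>j\<in>UNIV. mpoly_eval (mpoly_pderiv j p) ?z * (x $ j - y $ j))"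
    by (subst sum.swap) (simp add: mpoly_pderiv_def mpoly_eval_sum sum_distrib_right)
  finally show ?thesis .
qed

definition matrix_eval ::
  "('n::finite, 'a::comm_ring_1) mpoly ^ 'k ^ 'm \<Rightarrow> 'a ^ 'n \<Rightarrow> 'a ^ 'k ^ 'm" where
  "matrix_eval A x = (\<chi> i j. mpoly_eval (A $ i $ j) x)"

text \<open>Evaluation at a point is a ring homomorphism on the entries, so it respects matrix
  products. This carries nilpotency from the polynomial Jacobi matrix to its value at any
  point.\<close>

lemma matrix_eval_mult: "matrix_eval (A ** B) x = matrix_eval A x ** matrix_eval B x"
  by (simp add: matrix_eval_def matrix_matrix_mult_def mpoly_eval_sum mpoly_eval_mult vec_eq_iff)

lemma matrix_eval_mat_1: "matrix_eval (mat 1) x = mat 1"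
  by (simp add: matrix_eval_def mat_def vec_eq_iff)

lemma matrix_eval_power_fixed:
  assumes "matrix_eval A x *v v = v"
  shows "matrix_eval (matrix_power A k) x *v v = v"
  by (induction k)
    (simp_all add: matrix_power_def matrix_eval_mat_1 matrix_eval_mult assms
      flip: matrix_vector_mul_assoc)

theorem theorem9:
  fixes P :: "('n::finite, complex) mpoly ^ 'n"
    and N :: "complex ^ 'n \<Rightarrow> complex ^ 'n"
  assumes "N = poly_morphism P"
    and "nilpotent_morphism P"
    and "poly_deg P \<le> 2"
  shows "\<exists>\<^sub>\<le>\<^sub>1 x. N x = x"
proof (rule Uniq_I)
  fix x y
  assume fixed: "N x = x" "N y = y"
  \<comment> \<open>One midpoint serves all components of \<open>P\<close>, so their difference
    identities are the rows of a single matrix equation.\<close>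
  let ?z = "\<chi> i. (x $ i + y $ i) / 2"
  have deg: "mpoly_degree (P $ i) \<le> 2" for i
    using assms(3) by (auto simp: poly_deg_def)
  have "x $ i - y $ i = (matrix_eval (jacobi_matrix P) ?z *v (x - y)) $ i" for i
  proof -
    have "x $ i - y $ i = mpoly_eval (P $ i) x - mpoly_eval (P $ i) y"
      using fixed unfolding assms(1) poly_morphism_def vec_eq_iff by simp
    then show ?thesis
      by (simp add: mpoly_eval_diff_midpoint[OF deg] matrix_vector_mult_def matrix_eval_def
          jacobi_matrix_def)
  qed
  then have "matrix_eval (jacobi_matrix P) ?z *v (x - y) = x - y"
    by (simp add: vec_eq_iff)
  \<comment> \<open>Nilpotency is an identity between polynomial matrices, so it may be evaluated at
    \<open>?z\<close>: the power that fixes \<open>x - y\<close> is the zero matrix.\<close>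
  from matrix_eval_power_fixed[OF this, of "CARD('n)"]
  have "matrix_eval 0 ?z *v (x - y) = x - y"
    using assms(2) by (simp add: nilpotent_morphism_def)
  then show "x = y"
    by (simp add: matrix_eval_def matrix_vector_mult_def vec_eq_iff)
qed

end
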